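(* Let $\mathcal F$ be a nonmeager-bounding semifilter with $\mathfrak b(\mathcal F)=\mathfrak d$. Then there is a cofinal $\mathfrak b(\mathcal F)$-scale $S=\{f_\alpha:\alpha<\mathfrak d\}$ such that the set $X=S\cup Q$, viewed as a subspace of $\overline{\mathbb N}^{\uparrow\mathbb N}$, satisfies $\mathbf B(\mathcal F)$ but does not have the Hurewicz property.
   Context: $\mathbb N=\{0,1,2,\dots\}$, discrete; $\mathbb N^{\mathbb N}$ has the product topology. $[\mathbb N]^{\aleph_0}$ is the family of infinite subsets of $\mathbb N$; $A\subseteq^*B$ means $A\setminus B$ is finite. A semifilter is a nonempty $\mathcal F\subseteq[\mathbb N]^{\aleph_0}$ such that $A\in\mathcal F$, $B\subseteq\mathbb N$ and $A\subseteq^*B$ imply $B\in\mathcal F$. For $f,g\in\mathbb N^{\mathbb N}$, $f\le_{\mathcal F}g$ means $\{n:f(n)\le g(n)\}\in\mathcal F$, and $f\le^*g$ means $f(n)\le g(n)$ for all but finitely many $n$. A set $Y\subseteq\mathbb N^{\mathbb N}$ is bounded with respect to such a relation $R$ if there is $g\in\mathbb N^{\mathbb N}$ with $f\,R\,g$ for all $f\in Y$; otherwise it is unbounded. $\mathfrak b(\mathcal F)$ is the minimal cardinality of a subset of $\mathbb N^{\mathbb N}$ unbounded with respect to $\le_{\mathcal F}$; $\mathfrak d$ is the minimal cardinality of a dominating family, i.e. of a $D\subseteq\mathbb N^{\mathbb N}$ such that each $g\in\mathbb N^{\mathbb N}$ satisfies $g\le^*f$ for some $f\in D$. A space satisfies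 $\mathbf B(\mathcal F)$ if each of its continuous images in $\mathbb N^{\mathbb N}$ is bounded with respect to $\le_{\mathcal F}$; it has the Hurewicz property if each of its continuous images in $\mathbb N^{\mathbb N}$ is bounded with respect to $\le^*$. $\mathbb N^{\uparrow\mathbb N}$ is the subspace of (strictly) increasing elements of $\mathbb N^{\mathbb N}$. A semifilter $\mathcal S$ is nonmeager-bounding if for each $Y\subseteq\mathbb N^{\mathbb N}$ with $|Y|<\mathfrak b(\mathcal S)$, the set $\{g\in\mathbb N^{\uparrow\mathbb N}:(\forall f\in Y)\ f\le_{\mathcal S}g\}$ is nonmeager (in $\mathbb N^{\uparrow\mathbb N}$). A cofinal $\mathfrak b(\mathcal F)$-scale is a family $\{f_\alpha:\alpha<\mathfrak b(\mathcal F)\}\subseteq\mathbb N^{\uparrow\mathbb N}$ such that (1) $f_\alpha\le_{\mathcal F}f_\beta$ for all $\alpha<\beta<\mathfrak b(\mathcal F)$; and (2) for each $g\in\mathbb N^{\mathbb N}$ there is $\alpha<\mathfrak b(\mathcal F)$ such that $g\le_{\mathcal F}f_\beta$ for each $\beta\ge\alpha$. $\overline{\mathbb N}=\mathbb N\cup\{\infty\}$ is the one-point compactification of $\mathbb N$. $\overline{\mathbb N}^{\uparrow\mathbb N}$ is the subspace of the product $\overline{\mathbb N}^{\mathbb N}$ consisting of the nondecreasing $f$ such that $f(n)<f(n+1)$ whenever $f(n)<\infty$. $Q$ is the (countable) set of all $f\in\overline{\mathbb N}^{\uparrow\mathbb N}$ that take the value $\infty$; thus $\overline{\mathbb N}^{\uparrow\mathbb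 N}=Q\cup\mathbb N^{\uparrow\mathbb N}$. *)

theory Defs
  imports "HOL-Analysis.Analysis"
begin

unbundle cardinal_syntax

section \<open>Semifilters and the associated relations\<close>

definition semifilter :: "nat set set \<Rightarrow> bool" where
  "semifilter F \<longleftrightarrow> F \<noteq> {} \<and> (\<forall>A\<in>F. infinite A) \<and>
     (\<forall>A B. A \<in> F \<longrightarrow> finite (A - B) \<longrightarrow> B \<in> F)"

definition le_mod :: "nat set set \<Rightarrow> (nat \<Rightarrow> nat) \<Rightarrow> (nat \<Rightarrow> nat) \<Rightarrow> bool" where
  "le_mod F f g \<longleftrightarrow> {n. f n \<le> g n} \<in> F"

definition le_star :: "(nat \<Rightarrow> nat) \<Rightarrow> (nat \<Rightarrow> nat) \<Rightarrow> bool" where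
  "le_star f g \<longleftrightarrow> (\<forall>\<^sub>\<infinity>n. f n \<le> g n)"

definition bounded_wrt :: "('a \<Rightarrow> 'a \<Rightarrow> bool) \<Rightarrow> 'a set \<Rightarrow> bool" where
  "bounded_wrt R Y \<longleftrightarrow> (\<exists>g. \<forall>f\<in>Y. R f g)"

definition dominating :: "(nat \<Rightarrow> nat) set \<Rightarrow> bool" where
  "dominating D \<longleftrightarrow> (\<forall>g. \<exists>f\<in>D. le_star g f)"


section \<open>Cardinal characteristics\<close>

text \<open>
  A cardinal is represented, as in the library's cardinal theory, by a well-order of minimal
  order type (\<^const>\<open>Card_order\<close>).  The choice of the set in \<open>min_card\<close> is immaterial: by
  minimality, any two choices yield order-isomorphic well-orders.
\<close>

definition min_card :: "('a set \<Rightarrow> bool) \<Rightarrow> 'a rel" where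
  "min_card P = |SOME Y. P Y \<and> (\<forall>Z. P Z \<longrightarrow> |Y| \<le>o |Z| )|"

lemma min_card:
  assumes "P Y0"
  shows "\<exists>Y. P Y \<and> min_card P = |Y|" and "P Z \<Longrightarrow> min_card P \<le>o |Z|"
proof -
  have "\<exists>r \<in> card_of ` Collect P. \<forall>r' \<in> card_of ` Collect P. r \<le>o r'"
    by (rule exists_minim_Card_order) (use assms in \<open>auto intro: card_of_Card_order\<close>)
  then have "\<exists>Y. P Y \<and> (\<forall>Z. P Z \<longrightarrow> |Y| \<le>o |Z| )"
    by auto
  from someI_ex[OF this]
  show "\<exists>Y. P Y \<and> min_card P = |Y|" and "P Z \<Longrightarrow> min_card P \<le>o |Z|"
    unfolding min_card_def by blast+
qed

definition bnum :: "nat set set \<Rightarrow> (nat \<Rightarrow> nat) rel" where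
  "bnum F = min_card (\<lambda>Y. \<not> bounded_wrt (le_mod F) Y)"

lemma unbounded_UNIV:
  assumes "semifilter F"
  shows "\<not> bounded_wrt (le_mod F) UNIV"
proof
  assume "bounded_wrt (le_mod F) UNIV"
  then obtain g where "le_mod F (\<lambda>n. Suc (g n)) g"
    by (auto simp: bounded_wrt_def)
  then show False
    using assms by (auto simp: le_mod_def semifilter_def)
qed

definition dnum :: "(nat \<Rightarrow> nat) rel" where
  "dnum = min_card dominating"

lemma dominating_UNIV: "dominating UNIV"
proof -
  have "le_star g g" for g
    by (simp add: le_star_def)
  then show ?thesis
    unfolding dominating_def by blast
qed


section \<open>Category\<close>

definition nowhere_dense_in :: "'a topology \<Rightarrow> 'a set \<Rightarrow> bool" where
  "nowhere_dense_in X A \<longleftrightarrow> A \<subseteq> topspace X \<and> X interior_of (X closure_of A) = {}"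

definition meager_in :: "'a topology \<Rightarrow> 'a set \<Rightarrow> bool" where
  "meager_in X A \<longleftrightarrow> (\<exists>\<N>. countable \<N> \<and> (\<forall>N\<in>\<N>. nowhere_dense_in X N) \<and> A = \<Union>\<N>)"

definition increasing_seqs :: "(nat \<Rightarrow> nat) set" where
  "increasing_seqs = {f. strict_mono f}"

definition nonmeager_bounding :: "nat set set \<Rightarrow> bool" where
  "nonmeager_bounding F \<longleftrightarrow>
     (\<forall>Y. |Y| <o bnum F \<longrightarrow>
        \<not> meager_in (top_of_set increasing_seqs)
            {g \<in> increasing_seqs. \<forall>f\<in>Y. le_mod F f g})"


section \<open>Cofinal scales\<close>

text \<open>
  The ordinals below the cardinal \<open>\<bb>(F)\<close> are represented by the elements of the field of the
  well-order \<^term>\<open>bnum F\<close>, whose order type is the initial ordinal \<open>\<bb>(F)\<close>.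
\<close>

definition cofinal_scale :: "nat set set \<Rightarrow> ((nat \<Rightarrow> nat) \<Rightarrow> (nat \<Rightarrow> nat)) \<Rightarrow> bool" where
  "cofinal_scale F f \<longleftrightarrow>
     (\<forall>\<alpha>\<in>Field (bnum F). f \<alpha> \<in> increasing_seqs) \<and>
     (\<forall>\<alpha> \<beta>. (\<alpha>, \<beta>) \<in> bnum F \<longrightarrow> \<alpha> \<noteq> \<beta> \<longrightarrow> le_mod F (f \<alpha>) (f \<beta>)) \<and>
     (\<forall>g. \<exists>\<alpha>\<in>Field (bnum F). \<forall>\<beta>. (\<alpha>, \<beta>) \<in> bnum F \<longrightarrow> le_mod F g (f \<beta>))"


section \<open>Boundedness properties of spaces\<close>

definition B_property :: "nat set set \<Rightarrow> 'a topology \<Rightarrow> bool" where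
  "B_property F X \<longleftrightarrow>
     (\<forall>\<phi>. continuous_map X (euclidean :: (nat \<Rightarrow> nat) topology) \<phi> \<longrightarrow>
        bounded_wrt (le_mod F) (\<phi> ` topspace X))"

definition Hurewicz_property :: "'a topology \<Rightarrow> bool" where
  "Hurewicz_property X \<longleftrightarrow>
     (\<forall>\<phi>. continuous_map X (euclidean :: (nat \<Rightarrow> nat) topology) \<phi> \<longrightarrow>
        bounded_wrt le_star (\<phi> ` topspace X))"


section \<open>The extended increasing sequences\<close>

text \<open>
  The order topology of \<^typ>\<open>enat\<close> is that of the one-point compactification of the discrete
  space \<^typ>\<open>nat\<close>, see lemma \<open>open_enat_iff\<close>; function types carry the product topology.
\<close>

definition ext_increasing_seqs :: "(nat \<Rightarrow> enat) set" where
  "ext_increasing_seqs = {f. mono f \<and> (\<forall>n. f n < \<infinity> \<longrightarrow> f n < f (Suc n))}"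

definition Q :: "(nat \<Rightarrow> enat) set" where
  "Q = {f \<in> ext_increasing_seqs. \<exists>n. f n = \<infinity>}"

definition to_ext :: "(nat \<Rightarrow> nat) \<Rightarrow> (nat \<Rightarrow> enat)" where
  "to_ext f = (\<lambda>n. enat (f n))"

lemma ext_increasing_seqs_eq: "ext_increasing_seqs = Q \<union> to_ext ` increasing_seqs"
proof (intro equalityI subsetI)
  fix f assume f: "f \<in> ext_increasing_seqs"
  show "f \<in> Q \<union> to_ext ` increasing_seqs"
  proof (cases "\<exists>n. f n = \<infinity>")
    case True
    with f show ?thesis by (simp add: Q_def)
  next
    case False
    then have "\<forall>n. \<exists>m. f n = enat m"
      by simp
    then obtain h where h: "\<And>n. f n = enat (h n)"
      by metis
    then have "strict_mono h"
      using f by (simp add: strict_mono_Suc_iff ext_increasing_seqs_def)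
    moreover have "f = to_ext h"
      using h by (simp add: to_ext_def fun_eq_iff)
    ultimately show ?thesis
      by (simp add: increasing_seqs_def)
  qed
next
  fix f assume "f \<in> Q \<union> to_ext ` increasing_seqs"
  then consider "f \<in> Q" | h where "strict_mono h" "f = to_ext h"
    by (auto simp: increasing_seqs_def)
  then show "f \<in> ext_increasing_seqs"
  proof cases
    case 2
    then show ?thesis
      by (simp add: ext_increasing_seqs_def to_ext_def mono_def strict_mono_less_eq strict_mono_less)
  qed (simp add: Q_def)
qed

end

theory Submission
  imports Defs
begin

text \<open>
  Enumerate a dominating family as \<open>d\<close>, indexed by \<open>\<bb>(F) = \<dd>\<close>, and choose \<open>f \<alpha>\<close> by transfinite
  recursion above all \<open>f \<beta>\<close>, \<open>d \<beta>\<close> with \<open>\<beta> < \<alpha>\<close>, above \<open>d \<alpha>\<close>, and outside the meager set of those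
  sequences whose range misses a point of \<open>[n, d \<alpha> n]\<close> for almost all \<open>n\<close>; nonmeager-bounding makes
  this possible.  The map sending \<open>x\<close> and \<open>n\<close> to the least \<open>k \<ge> n\<close> outside the range of \<open>x\<close> is then
  continuous with unbounded image, so the Hurewicz property fails.

  For \<open>B(F)\<close>, compactness of the space of extended sequences and \<open>Q \<subseteq> X\<close> yield, for continuous \<open>\<psi>\<close>,
  some \<open>g\<close> with \<open>\<psi> x n \<le> g n\<close> whenever \<open>x n > g n\<close>.  Hence \<open>g\<close> bounds the images of a final segment
  of the scale, and what remains is fewer than \<open>\<bb>(F)\<close> points together with the countable set \<open>Q\<close>.
\<close>

section \<open>Semifilters and cardinals\<close>

lemma semifilter_upward:
  assumes "semifilter F" "A \<in> F" "finite (A - B)"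
  shows "B \<in> F"
  using assms unfolding semifilter_def by blast

lemma semifilter_infinite: "semifilter F \<Longrightarrow> A \<in> F \<Longrightarrow> infinite A"
  unfolding semifilter_def by blast

lemma le_mod_mono:
  assumes "semifilter F" "le_mod F f g" "\<And>n. f n \<le> g n \<Longrightarrow> f' n \<le> g' n"
  shows "le_mod F f' g'"
proof -
  have "{n. f n \<le> g n} - {n. f' n \<le> g' n} = {}"
    using assms(3) by auto
  then show ?thesis
    using semifilter_upward[OF assms(1)] assms(2) unfolding le_mod_def by (metis finite.emptyI)
qed

text \<open>Members of \<open>F\<close> absorb finitely many exceptions. This mixed form stands in
  for transitivity of \<open>le_mod F\<close>, which can fail because a semifilter need not be
  closed under intersections.\<close>

lemma le_star_le_mod_trans:
  assumes "semifilter F" "le_star f g" "le_mod F g h"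
  shows "le_mod F f h"
proof -
  have "{n. g n \<le> h n} - {n. f n \<le> h n} \<subseteq> {n. \<not> f n \<le> g n}"
    by auto
  moreover have "finite {n. \<not> f n \<le> g n}"
    using assms(2) by (simp add: le_star_def MOST_iff_cofinite)
  ultimately show ?thesis
    using assms(1,3) semifilter_upward finite_subset unfolding le_mod_def by metis
qed

lemma le_mod_refl:
  assumes "semifilter F"
  shows "le_mod F f f"
proof -
  obtain A where "A \<in> F"
    using assms unfolding semifilter_def by blast
  then show ?thesis
    using semifilter_upward[OF assms, of A UNIV] by (simp add: le_mod_def)
qed

lemma le_star_le_mod:
  assumes "semifilter F" "le_star f g"
  shows "le_mod F f g"
  using le_star_le_mod_trans[OF assms le_mod_refl[OF assms(1)]] .

text \<open>Diagonal bound: \<open>g n\<close> majorizes the first \<open>n + 1\<close> members at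
  \<open>n\<close>, so the \<open>i\<close>-th member lies below \<open>g\<close> from
  \<open>i\<close> on.\<close>

lemma countable_bounded_le_star:
  assumes "countable Y"
  shows "bounded_wrt le_star Y"
proof (cases "Y = {}")
  case False
  define g where "g n = Max ((\<lambda>i. from_nat_into Y i n) ` {..n})" for n
  have "le_star f g" if "f \<in> Y" for f
  proof -
    obtain i where i: "f = from_nat_into Y i"
      using \<open>f \<in> Y\<close> assms by (metis from_nat_into_surj)
    have "f n \<le> g n" if "n \<ge> i" for n
      unfolding g_def i using that by (intro Max_ge) auto
    then show ?thesis
      unfolding le_star_def MOST_nat_le by blast
  qed
  then show ?thesis
    unfolding bounded_wrt_def by blast
qed (simp add: bounded_wrt_def)

text \<open>Each \<open>f\<close> is compared with only one of the two bounds, so their pointwise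
  maximum works without intersecting members of \<open>F\<close>.\<close>

lemma bounded_wrt_le_mod_Un:
  assumes F: "semifilter F"
    and "bounded_wrt (le_mod F) A" "bounded_wrt (le_mod F) B"
  shows "bounded_wrt (le_mod F) (A \<union> B)"
proof -
  obtain a b where a: "\<And>f. f \<in> A \<Longrightarrow> le_mod F f a" and b: "\<And>f. f \<in> B \<Longrightarrow> le_mod F f b"
    using assms(2,3) unfolding bounded_wrt_def by blast
  have "le_mod F f (\<lambda>n. max (a n) (b n))" if "f \<in> A \<union> B" for f
    using that by (auto intro: le_mod_mono[OF F a] le_mod_mono[OF F b])
  then show ?thesis
    unfolding bounded_wrt_def by blast
qed

lemma bounded_wrt_subset: "bounded_wrt R B \<Longrightarrow> A \<subseteq> B \<Longrightarrow> bounded_wrt R A"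
  unfolding bounded_wrt_def by blast

section \<open>Cardinal arithmetic below \<open>bnum F\<close>\<close>

context
  fixes F :: "nat set set"
  assumes F: "semifilter F"
begin

lemma bnum_eq: "\<exists>Y. \<not> bounded_wrt (le_mod F) Y \<and> bnum F = |Y|"
  unfolding bnum_def by (rule min_card(1)) (rule unbounded_UNIV[OF F])

lemma Card_order_bnum: "Card_order (bnum F)"
  using bnum_eq by (metis card_of_Card_order)

lemma bounded_if_less_bnum:
  assumes "|Y| <o bnum F"
  shows "bounded_wrt (le_mod F) Y"
proof (rule ccontr)
  assume *: "\<not> bounded_wrt (le_mod F) Y"
  have "bnum F \<le>o |Y|"
    unfolding bnum_def by (rule min_card(2)) (rule unbounded_UNIV[OF F], rule *)
  then show False
    using assms not_ordLess_ordLeq by blast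
qed

lemma countable_bounded_le_mod:
  assumes "countable Y"
  shows "bounded_wrt (le_mod F) Y"
  using countable_bounded_le_star[OF assms] le_star_le_mod[OF F] unfolding bounded_wrt_def by blast

text \<open>Countable families are bounded, so an unbounded family realizing \<open>bnum F\<close>
  is uncountable.\<close>

lemma infinite_Field_bnum: "infinite (Field (bnum F))"
  using bnum_eq countable_bounded_le_mod
  by (metis Field_card_of uncountable_infinite)

lemma Un_less_bnum: "|A| <o bnum F \<Longrightarrow> |B| <o bnum F \<Longrightarrow> |A \<union> B| <o bnum F"
  using card_of_Un_ordLess_infinite_Field infinite_Field_bnum Card_order_bnum by blast

lemma finite_less_bnum:
  assumes "finite A"
  shows "|A| <o bnum F"
proof -
  obtain Y where Y: "\<not> bounded_wrt (le_mod F) Y" "bnum F = |Y|"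
    using bnum_eq by blast
  then have "infinite Y"
    using infinite_Field_bnum by (simp add: Field_card_of)
  then show ?thesis
    unfolding Y(2) using assms
    by (intro finite_ordLess_infinite card_of_Well_order) (simp_all add: Field_card_of)
qed

lemma image_underS_less_bnum:
  assumes "a \<in> Field (bnum F)"
  shows "|h ` underS (bnum F) a| <o bnum F"
  using card_of_underS[OF Card_order_bnum assms] card_of_image ordLeq_ordLess_trans by blast

end

section \<open>Sequences with few gaps are meager\<close>

text \<open>\<open>meager_in\<close> asks for equality with a countable union, so the pieces are cut
  down to \<open>A\<close>.\<close>

lemma meager_in_subset:
  assumes "meager_in X B" "A \<subseteq> B"
  shows "meager_in X A"
proof -
  obtain \<N> where N: "countable \<N>" "\<forall>N\<in>\<N>. nowhere_dense_in X N" "B = \<Union>\<N>"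
    using assms(1) unfolding meager_in_def by (elim exE conjE)
  have "nowhere_dense_in X (N \<inter> A)" if "N \<in> \<N>" for N
  proof -
    have "X interior_of (X closure_of (N \<inter> A)) \<subseteq> X interior_of (X closure_of N)"
      by (intro interior_of_mono closure_of_mono) auto
    then show ?thesis
      using N(2) that unfolding nowhere_dense_in_def by blast
  qed
  moreover have "A = \<Union> ((\<lambda>N. N \<inter> A) ` \<N>)"
    using N(3) assms(2) by auto
  ultimately show ?thesis
    unfolding meager_in_def using N(1) by (intro exI[of _ "(\<lambda>N. N \<inter> A) ` \<N>"]) auto
qed

lemma open_cylinder: "open {g :: nat \<Rightarrow> 'a::discrete_topology. \<forall>i<K. g i = a i}"
proof -
  have "open {g :: nat \<Rightarrow> 'a. g i = a i}" for i
  proof -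
    have "open ((\<lambda>g :: nat \<Rightarrow> 'a. g i) -` {a i})"
      by (intro open_vimage continuous_on_product_coordinates) (rule open_discrete)
    then show ?thesis
      by (simp add: vimage_def)
  qed
  then have "open (\<Inter>i\<in>{..<K}. {g :: nat \<Rightarrow> 'a. g i = a i})"
    by (intro open_INT) auto
  also have "(\<Inter>i\<in>{..<K}. {g :: nat \<Rightarrow> 'a. g i = a i}) = {g. \<forall>i<K. g i = a i}"
    by auto
  finally show ?thesis .
qed

lemma open_contains_cylinder:
  fixes U :: "(nat \<Rightarrow> 'a::topological_space) set"
  assumes "open U" "g \<in> U"
  obtains K where "{g'. \<forall>i<K. g' i = g i} \<subseteq> U"
proof -
  have "openin (product_topology (\<lambda>i. euclidean) UNIV) U"
    using assms(1) by (simp add: open_fun_def)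
  from product_topology_open_contains_basis[OF this assms(2)]
  obtain X where X: "g \<in> PiE UNIV X" "finite {i. X i \<noteq> UNIV}" "PiE UNIV X \<subseteq> U"
    by auto
  obtain K where K: "\<And>i. X i \<noteq> UNIV \<Longrightarrow> i < K"
    using X(2) unfolding finite_nat_set_iff_bounded by auto
  have "{g'. \<forall>i<K. g' i = g i} \<subseteq> PiE UNIV X"
  proof (clarsimp simp: PiE_UNIV_domain)
    fix g' i assume "\<forall>i<K. g' i = g i"
    then show "g' i \<in> X i"
      using K[of i] X(1) by (cases "i < K") (auto simp: PiE_iff)
  qed
  from that[OF order.trans[OF this X(3)]] show ?thesis .
qed

text \<open>The union over \<open>N\<close> consists of the increasing sequences whose next gap
  after \<open>n\<close> is at most \<open>h n\<close> for almost all \<open>n\<close>; fixing the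
  threshold \<open>N\<close> makes each piece nowhere dense.\<close>

definition gap_bounded :: "(nat \<Rightarrow> nat) \<Rightarrow> nat \<Rightarrow> (nat \<Rightarrow> nat) set" where
  "gap_bounded h N = {g \<in> increasing_seqs. \<forall>n\<ge>N. \<exists>k\<in>{n..h n}. k \<notin> range g}"

text \<open>Every finite initial part extends by a run of consecutive integers covering some
  \<open>{m..h m}\<close> with \<open>m \<ge> N\<close>. Sequences close enough to the extension
  cover this interval too, so they avoid the set.\<close>

lemma nowhere_dense_gap_bounded:
  "nowhere_dense_in (top_of_set increasing_seqs) (gap_bounded h N)"
proof -
  let ?X = "top_of_set increasing_seqs"
  have "g \<notin> ?X interior_of (?X closure_of gap_bounded h N)" for g
  proof
    assume "g \<in> ?X interior_of (?X closure_of gap_bounded h N)"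
    then obtain T where T: "openin ?X T" "g \<in> T" "T \<subseteq> ?X closure_of gap_bounded h N"
      unfolding interior_of_def by blast
    then obtain U where U: "open U" "T = increasing_seqs \<inter> U"
      by (auto simp: openin_open)
    obtain K where K: "{g'. \<forall>i<K. g' i = g i} \<subseteq> U"
      using open_contains_cylinder U T(2) by blast
    have g: "strict_mono g"
      using T(2) U(2) by (simp add: increasing_seqs_def)
    \<comment> \<open>\<open>m \<ge> N\<close> brings the run under the condition in
      \<open>gap_bounded h N\<close>; \<open>m \<ge> g K\<close> keeps \<open>g'\<close> strictly
      increasing where the run starts.\<close>
    define m where "m = max N (g K)"
    define g' where "g' i = (if i < K then g i else m + (i - K))" for i
    have "g' i < g' (Suc i)" for i
    proof -
      have "g i < g K" if "i < K"
        using g that by (simp add: strict_mono_less)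
      moreover have "g i < g (Suc i)"
        using g by (simp add: strict_mono_less)
      ultimately show ?thesis
        unfolding g'_def m_def by auto
    qed
    then have g': "g' \<in> increasing_seqs"
      by (simp add: increasing_seqs_def strict_mono_Suc_iff)
    have "g' \<in> T"
      using K U(2) g' by (auto simp: g'_def)
    from subsetD[OF T(3) this, unfolded in_closure_of, THEN conjunct2]
    have cl: "g' \<in> V \<Longrightarrow> openin ?X V \<Longrightarrow> \<exists>f. f \<in> gap_bounded h N \<and> f \<in> V" for V
      by (elim allE[of _ V]) simp
    \<comment> \<open>The values in \<open>{m..h m}\<close> are taken by \<open>g'\<close> at
      indices between \<open>K\<close> and \<open>K + h m\<close>, so \<open>K + Suc (h m)\<close>
      coordinates are enough to preserve them.\<close>
    have "\<exists>f. f \<in> gap_bounded h N \<and> f \<in> increasing_seqs \<inter> {f. \<forall>i<K + Suc (h m). f i = g' i}"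
    proof (rule cl)
      show "openin ?X (increasing_seqs \<inter> {f. \<forall>i<K + Suc (h m). f i = g' i})"
        by (intro openin_open_Int open_cylinder)
    qed (simp add: g')
    then obtain f where f: "f \<in> gap_bounded h N" "\<And>i. i < K + Suc (h m) \<Longrightarrow> f i = g' i"
      by auto
    have "k \<in> range f" if "k \<in> {m..h m}" for k
    proof -
      have "f (K + (k - m)) = g' (K + (k - m))"
        using that by (intro f(2)) auto
      also have "\<dots> = k"
        using that by (auto simp: g'_def)
      finally show ?thesis
        by (metis rangeI)
    qed
    moreover have "N \<le> m"
      by (simp add: m_def)
    ultimately show False
      using f(1) unfolding gap_bounded_def by blast
  qed
  then show ?thesis
    unfolding nowhere_dense_in_def by (auto simp: gap_bounded_def)
qed

lemma meager_gap_bounded: "meager_in (top_of_set increasing_seqs) (\<Union>N. gap_bounded h N)"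
  unfolding meager_in_def
proof (intro exI conjI ballI)
  show "countable (range (gap_bounded h))"
    by simp
  fix A assume "A \<in> range (gap_bounded h)"
  then show "nowhere_dense_in (top_of_set increasing_seqs) A"
    using nowhere_dense_gap_bounded by (elim imageE) simp
qed simp

section \<open>The extended increasing sequences\<close>

text \<open>A member of \<open>Q\<close> is determined by the finite list of its values before the
  first \<infinity>.\<close>

lemma countable_Q: "countable Q"
proof -
  have "q \<in> range (\<lambda>l i. if i < length l then enat (l ! i) else \<infinity>)" if "q \<in> Q" for q
  proof -
    define n where "n = (LEAST n. q n = \<infinity>)"
    have q: "\<exists>n. q n = \<infinity>" "mono q"
      using that by (auto simp: Q_def ext_increasing_seqs_def)
    have n: "q n = \<infinity>"
      unfolding n_def using q(1) by (rule LeastI_ex)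
    have "q i = (if i < length (map (the_enat \<circ> q) [0..<n]) then enat (map (the_enat \<circ> q) [0..<n] ! i) else \<infinity>)" for i
    proof (cases "i < n")
      case True
      then have "q i \<noteq> \<infinity>"
        unfolding n_def using not_less_Least by blast
      then show ?thesis
        using True by auto
    next
      case False
      then have "q n \<le> q i"
        using q(2) by (simp add: mono_def)
      then show ?thesis
        using n False by simp
    qed
    then show ?thesis
      by (intro range_eqI[of _ _ "map (the_enat \<circ> q) [0..<n]"]) (rule ext)
  qed
  then have "Q \<subseteq> range (\<lambda>(l :: nat list) i. if i < length l then enat (l ! i) else \<infinity>)"
    by blast
  then show ?thesis
    by (rule countable_subset) simp
qed

section \<open>Compactness and limits of extended sequences\<close>

lemma seq_compact_enat_fun: "seq_compact (UNIV :: (nat \<Rightarrow> enat) set)"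
proof -
  have "compact_space (euclidean :: enat topology)"
    using compact_UNIV[where 'a = enat] by (simp add: compact_space_def)
  then have "compact_space (product_topology (\<lambda>i::nat. euclidean :: enat topology) UNIV)"
    by (simp add: compact_space_product_topology)
  then have "compact (UNIV :: (nat \<Rightarrow> enat) set)"
    unfolding euclidean_product_topology by (simp add: compact_space_def)
  then show ?thesis
    by (rule compact_imp_seq_compact)
qed

lemma tendsto_fun_coordinate:
  fixes x :: "'b \<Rightarrow> 'a \<Rightarrow> 'c::topological_space"
  assumes "(x \<longlongrightarrow> l) G"
  shows "((\<lambda>k. x k n) \<longlongrightarrow> l n) G"
  using continuous_on_tendsto_compose[OF continuous_on_product_coordinates[of n] assms] by simp

text \<open>Finite points are isolated in the one-point compactification.\<close>

lemma eventually_eq_enat: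
  assumes "(x \<longlongrightarrow> enat m) G"
  shows "\<forall>\<^sub>F k in G. x k = enat m"
  using topological_tendstoD[OF assms open_enat] by simp

text \<open>Strict growth survives the limit because a finite value \<open>m\<close> of
  \<open>l n\<close> is attained by almost all \<open>x k n\<close>, which turns strictness into the
  closed condition \<open>enat (Suc m) \<le> x k (Suc n)\<close>.\<close>

lemma ext_increasing_seqs_limit:
  fixes x :: "nat \<Rightarrow> nat \<Rightarrow> enat"
  assumes x: "\<And>k. x k \<in> ext_increasing_seqs" and lim: "x \<longlonglongrightarrow> l"
  shows "l \<in> ext_increasing_seqs"
  unfolding ext_increasing_seqs_def
proof (intro CollectI conjI monoI allI impI)
  note c = tendsto_fun_coordinate[OF lim]
  show "l i \<le> l j" if "i \<le> j" for i j
    using x that by (intro LIMSEQ_le[OF c c]) (auto simp: ext_increasing_seqs_def mono_def)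
  show "l n < l (Suc n)" if "l n < \<infinity>" for n
  proof -
    obtain m where m: "l n = enat m"
      using \<open>l n < \<infinity>\<close> by auto
    then have "\<forall>\<^sub>F k in sequentially. x k n = enat m"
      using eventually_eq_enat c by metis
    then have "\<forall>\<^sub>F k in sequentially. enat (Suc m) \<le> x k (Suc n)"
    proof eventually_elim
      case (elim k)
      then have "enat m < x k (Suc n)"
        using x[of k] unfolding ext_increasing_seqs_def by (auto dest!: spec[of _ n])
      then show ?case
        using Suc_ile_eq by blast
    qed
    then have "enat (Suc m) \<le> l (Suc n)"
      by (intro tendsto_lowerbound[OF c]) auto
    then show ?thesis
      using m Suc_ile_eq by simp
  qed
qed

text \<open>If no bound exists at coordinate \<open>n\<close>, then there are points with both
  \<open>x m n\<close> and \<open>\<psi> (x m) n\<close> above \<open>m\<close>. A limit of a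
  subsequence takes the value \<infinity> at \<open>n\<close>, hence lies in \<open>Q\<close>, and
  continuity of \<open>\<psi>\<close> there keeps the values at \<open>n\<close> bounded along the
  subsequence. A single \<open>g\<close> serves as threshold and as bound.\<close>

lemma continuous_image_bound_off_Q:
  fixes \<psi> :: "(nat \<Rightarrow> enat) \<Rightarrow> nat \<Rightarrow> nat"
  assumes X: "Q \<subseteq> X" "X \<subseteq> ext_increasing_seqs" and cont: "continuous_on X \<psi>"
  obtains g where "\<And>x n. x \<in> X \<Longrightarrow> enat (g n) < x n \<Longrightarrow> \<psi> x n \<le> g n"
proof -
  have "\<exists>m. \<forall>x\<in>X. enat m < x n \<longrightarrow> \<psi> x n \<le> m" for n
  proof (rule ccontr)
    assume "\<not> ?thesis"
    then have "\<forall>m. \<exists>x. x \<in> X \<and> enat m < x n \<and> m < \<psi> x n"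
      by (auto simp: not_le)
    then obtain x where x: "\<And>m. x m \<in> X" "\<And>m. enat m < x m n" "\<And>m. m < \<psi> (x m) n"
      by metis
    obtain l r where r: "strict_mono (r :: nat \<Rightarrow> nat)" and lim: "(x \<circ> r) \<longlonglongrightarrow> l"
      using seq_compact_enat_fun unfolding seq_compact_def by blast
    have "l \<in> ext_increasing_seqs"
      using x(1) X(2) by (intro ext_increasing_seqs_limit[OF _ lim]) auto
    moreover have "l n = \<infinity>"
    proof (rule ccontr)
      assume "l n \<noteq> \<infinity>"
      then obtain m where "l n = enat m"
        by auto
      then have "((\<lambda>k. (x \<circ> r) k n) \<longlonglongrightarrow> enat m)"
        using tendsto_fun_coordinate[OF lim, of n] by simp
      then have "\<forall>\<^sub>F k in sequentially. x (r k) n = enat m"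
        using eventually_eq_enat by fastforce
      then have "\<forall>\<^sub>F k in sequentially. x (r k) n = enat m \<and> m \<le> k"
        by (intro eventually_conj eventually_ge_at_top)
      then obtain k where k: "x (r k) n = enat m" "m \<le> k"
        using eventually_happens by force
      moreover have "k \<le> r k"
        using r by (rule seq_suble)
      moreover have "enat (r k) < x (r k) n"
        by (rule x(2))
      ultimately show False
        by simp
    qed
    ultimately have "l \<in> Q"
      by (auto simp: Q_def)
    \<comment> \<open>Here \<open>Q \<subseteq> X\<close> matters: the limit lies in the domain of
      continuity.\<close>
    then have "(\<lambda>k. \<psi> ((x \<circ> r) k)) \<longlonglongrightarrow> \<psi> l"
      using X(1) x(1) by (intro continuous_on_tendsto_compose[OF cont lim]) auto
    then have "(\<lambda>k. \<psi> ((x \<circ> r) k) n) \<longlonglongrightarrow> \<psi> l n"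
      by (rule tendsto_fun_coordinate)
    then have "\<forall>\<^sub>F k in sequentially. \<psi> (x (r k)) n = \<psi> l n"
      by (simp add: tendsto_discrete)
    then have "\<forall>\<^sub>F k in sequentially. \<psi> (x (r k)) n = \<psi> l n \<and> \<psi> l n \<le> k"
      by (intro eventually_conj eventually_ge_at_top)
    then obtain k where k: "\<psi> (x (r k)) n = \<psi> l n" "\<psi> l n \<le> k"
      using eventually_happens by force
    have "k \<le> r k"
      using r by (rule seq_suble)
    with k x(3)[of "r k"] show False
      by simp
  qed
  then obtain g where "\<And>n x. x \<in> X \<Longrightarrow> enat (g n) < x n \<Longrightarrow> \<psi> x n \<le> g n"
    by metis
  then show ?thesis
    using that by blast
qed

section \<open>The next gap of a sequence\<close>

text \<open>\<open>LEAST\<close> is meaningful only if a gap at or beyond \<open>n\<close> exists,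
  so the results below assume infinitely many gaps.\<close>

definition next_gap :: "(nat \<Rightarrow> enat) \<Rightarrow> nat \<Rightarrow> nat" where
  "next_gap x n = (LEAST k. n \<le> k \<and> enat k \<notin> range x)"

lemma ext_increasing_seqs_ge_index:
  assumes "x \<in> ext_increasing_seqs"
  shows "enat n \<le> x n"
proof (induction n)
  case (Suc n)
  show ?case
  proof (cases "x n < \<infinity>")
    case True
    then have "x n < x (Suc n)"
      using assms by (simp add: ext_increasing_seqs_def)
    then show ?thesis
      using Suc Suc_ile_eq order.strict_trans1 by blast
  next
    case False
    then have "x n = \<infinity>"
      by simp
    moreover have "x n \<le> x (Suc n)"
      using assms monoD[of x n "Suc n"] by (simp add: ext_increasing_seqs_def)
    ultimately show ?thesis
      by simp
  qed
qed (simp add: zero_enat_def[symmetric])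

text \<open>As \<open>enat i \<le> x i\<close>, the value \<open>k\<close> can occur only at indices
  up to \<open>k\<close>. Membership in the range is thus a condition on finitely many
  coordinates.\<close>

lemma in_range_iff:
  assumes "x \<in> ext_increasing_seqs"
  shows "enat k \<in> range x \<longleftrightarrow> (\<exists>i\<le>k. x i = enat k)"
proof
  assume "enat k \<in> range x"
  then obtain i where i: "x i = enat k"
    by auto
  then have "i \<le> k"
    using ext_increasing_seqs_ge_index[OF assms, of i] by simp
  with i show "\<exists>i\<le>k. x i = enat k"
    by blast
qed (metis rangeI)

lemma next_gap:
  assumes "infinite {k. enat k \<notin> range x}"
  shows "n \<le> next_gap x n" "enat (next_gap x n) \<notin> range x"
proof -
  obtain k where "n \<le> k \<and> enat k \<notin> range x"
    using assms unfolding infinite_nat_iff_unbounded_le by blast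
  from LeastI[of "\<lambda>k. n \<le> k \<and> enat k \<notin> range x", OF this]
  show "n \<le> next_gap x n" "enat (next_gap x n) \<notin> range x"
    unfolding next_gap_def by blast+
qed

text \<open>Each coordinate is locally constant: it depends only on which
  \<open>k \<le> next_gap x n\<close> belong to the range, and this is decided by finitely many
  coordinates.\<close>

lemma continuous_on_next_gap:
  assumes X: "X \<subseteq> ext_increasing_seqs" and inf: "\<And>x. x \<in> X \<Longrightarrow> infinite {k. enat k \<notin> range x}"
  shows "continuous_on X next_gap"
proof (intro continuous_on_coordinatewise_then_product)
  fix n
  show "continuous_on X (\<lambda>x. next_gap x n)"
    unfolding continuous_on_def tendsto_discrete
  proof
    fix x assume x: "x \<in> X"
    \<comment> \<open>The singleton of \<open>enat k\<close> is both open and closed, so either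
      truth value persists near \<open>x\<close>.\<close>
    have ev: "\<forall>\<^sub>F y in at x within X. y i = enat k \<longleftrightarrow> x i = enat k" for i k
    proof -
      have t: "((\<lambda>y. y i) \<longlongrightarrow> x i) (at x within X)"
        by (rule tendsto_fun_coordinate) (rule tendsto_ident_at)
      show ?thesis
      proof (cases "x i = enat k")
        case True
        with t show ?thesis
          using eventually_eq_enat by fastforce
      next
        case False
        with topological_tendstoD[OF t, of "- {enat k}"] show ?thesis
          by (auto simp: open_Compl elim: eventually_mono)
      qed
    qed
    have "\<forall>\<^sub>F y in at x within X. \<forall>k\<in>{..next_gap x n}. \<forall>i\<in>{..k}. y i = enat k \<longleftrightarrow> x i = enat k"
      by (intro eventually_ball_finite ballI ev) auto
    moreover have "\<forall>\<^sub>F y in at x within X. y \<in> X"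
      by (simp add: eventually_at_filter)
    ultimately show "\<forall>\<^sub>F y in at x within X. next_gap y n = next_gap x n"
    proof eventually_elim
      case (elim y)
      then have eq: "enat k \<in> range y \<longleftrightarrow> enat k \<in> range x" if "k \<le> next_gap x n" for k
        using that X x by (simp add: in_range_iff subset_iff) blast
      show ?case
        unfolding next_gap_def[of y]
      proof (rule Least_equality)
        show "n \<le> next_gap x n \<and> enat (next_gap x n) \<notin> range y"
          using eq next_gap[OF inf[OF x]] by blast
        show "next_gap x n \<le> k" if "n \<le> k \<and> enat k \<notin> range y" for k
        proof (rule ccontr)
          assume *: "\<not> next_gap x n \<le> k"
          then have "n \<le> k \<and> enat k \<notin> range x"
            using eq[of k] that by simp
          then have "next_gap x n \<le> k"
            unfolding next_gap_def by (rule Least_le)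
          with * show False
            by simp
        qed
      qed
    qed
  qed
qed

text \<open>The range is finite, since \<open>q\<close> is constantly \<infinity> from some index
  on.\<close>

lemma infinite_gaps_Q:
  assumes "q \<in> Q"
  shows "infinite {k. enat k \<notin> range q}"
proof -
  obtain n where n: "q n = \<infinity>" and q: "mono q"
    using assms by (auto simp: Q_def ext_increasing_seqs_def)
  have "range q \<subseteq> insert \<infinity> (q ` {..<n})"
  proof clarify
    fix i assume "q i \<notin> q ` {..<n}"
    then have "q n \<le> q i"
      using q by (metis imageI lessThan_iff monoD not_le_imp_less)
    with n show "q i = \<infinity>"
      by simp
  qed
  then have "finite (range q)"
    by (rule finite_subset) simp
  then have "finite (enat -` range q)"
    by (rule finite_vimageI) (simp add: inj_def)
  moreover have "- {k. enat k \<notin> range q} = enat -` range q"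
    by auto
  ultimately show ?thesis
    using finite_compl infinite_UNIV_nat by metis
qed

text \<open>If \<open>f\<close> misses only \<open>c\<close> numbers, then the numbers below
  \<open>f n\<close> are at most \<open>n\<close> values of \<open>f\<close> and \<open>c\<close>
  missed ones. Hence \<open>f n \<le> n + c\<close>, and \<open>2 * n \<le> f n\<close> forces
  \<open>n \<le> c\<close>.\<close>

lemma infinite_gaps_to_ext:
  assumes f: "strict_mono f" and fast: "infinite {n. 2 * n \<le> f n}"
  shows "infinite {k. enat k \<notin> range (to_ext f)}"
proof
  assume fin: "finite {k. enat k \<notin> range (to_ext f)}"
  have eq: "{k. enat k \<notin> range (to_ext f)} = - range f"
    by (auto simp: to_ext_def)
  define c where "c = card (- range f)"
  have "2 * n \<le> f n \<Longrightarrow> n \<le> c" for n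
  proof -
    assume n: "2 * n \<le> f n"
    have "{..<f n} \<subseteq> f ` {..<n} \<union> - range f"
      using f by (auto simp: strict_mono_less)
    then have "card {..<f n} \<le> card (f ` {..<n} \<union> - range f)"
      using fin eq by (intro card_mono) auto
    also have "\<dots> \<le> card (f ` {..<n}) + c"
      unfolding c_def by (rule card_Un_le)
    also have "card (f ` {..<n}) \<le> n"
      using card_image_le[of "{..<n}" f] by simp
    finally show "n \<le> c"
      using n by simp
  qed
  then have "{n. 2 * n \<le> f n} \<subseteq> {..c}"
    by auto
  with fast show False
    using finite_subset by blast
qed

section \<open>Cofinal scales\<close>

lemma B_property_cofinal_scale:
  assumes F: "semifilter F" and scale: "cofinal_scale F f"
  shows "B_property F (top_of_set (to_ext ` f ` Field (bnum F) \<union> Q))"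
  unfolding B_property_def
proof (intro allI impI)
  let ?r = "bnum F"
  let ?X = "to_ext ` f ` Field ?r \<union> Q"
  fix \<psi> :: "(nat \<Rightarrow> enat) \<Rightarrow> nat \<Rightarrow> nat"
  assume "continuous_map (top_of_set ?X) euclidean \<psi>"
  then have cont: "continuous_on ?X \<psi>"
    by simp
  have sub: "?X \<subseteq> ext_increasing_seqs"
    using scale unfolding ext_increasing_seqs_eq cofinal_scale_def by auto
  obtain g where g: "\<And>x n. x \<in> ?X \<Longrightarrow> enat (g n) < x n \<Longrightarrow> \<psi> x n \<le> g n"
    using continuous_image_bound_off_Q[OF _ sub cont] by blast
  \<comment> \<open>The successor turns \<le> into the strict inequality \<open>g n < f b n\<close>
    under which \<open>g\<close> bounds \<open>\<psi>\<close>.\<close>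
  obtain a where a: "a \<in> Field ?r" and cof: "\<And>b. (a, b) \<in> ?r \<Longrightarrow> le_mod F (\<lambda>n. Suc (g n)) (f b)"
    using scale unfolding cofinal_scale_def by blast
  let ?late = "{b. (a, b) \<in> ?r}"
  have "bounded_wrt (le_mod F) ((\<lambda>b. \<psi> (to_ext (f b))) ` ?late)"
    unfolding bounded_wrt_def
  proof (intro exI ballI)
    fix h assume "h \<in> (\<lambda>b. \<psi> (to_ext (f b))) ` ?late"
    then obtain b where b: "(a, b) \<in> ?r" "h = \<psi> (to_ext (f b))"
      by auto
    then have "to_ext (f b) \<in> ?X"
      by (auto simp: Field_def)
    then show "le_mod F h g"
      unfolding b(2) using g by (intro le_mod_mono[OF F cof[OF b(1)]]) (auto simp: to_ext_def Suc_le_eq)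
  qed
  moreover have "bounded_wrt (le_mod F) ((\<lambda>b. \<psi> (to_ext (f b))) ` underS ?r a)"
    by (intro bounded_if_less_bnum[OF F] image_underS_less_bnum[OF F a])
  moreover have "bounded_wrt (le_mod F) (\<psi> ` Q)"
    by (intro countable_bounded_le_mod[OF F] countable_image countable_Q)
  ultimately have bd: "bounded_wrt (le_mod F)
      (\<psi> ` Q \<union> ((\<lambda>b. \<psi> (to_ext (f b))) ` ?late \<union> (\<lambda>b. \<psi> (to_ext (f b))) ` underS ?r a))"
    by (intro bounded_wrt_le_mod_Un[OF F])
  have "b \<in> ?late \<union> underS ?r a" if "b \<in> Field ?r" for b
  proof -
    have "Well_order ?r"
      using Card_order_bnum[OF F] by (simp add: card_order_on_def)
    then have "Total ?r" "Refl ?r"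
      by (auto simp: order_on_defs)
    then show ?thesis
      using a that unfolding underS_def total_on_def refl_on_def by (cases "a = b") auto
  qed
  then have "\<psi> ` topspace (top_of_set ?X) \<subseteq>
      \<psi> ` Q \<union> ((\<lambda>b. \<psi> (to_ext (f b))) ` ?late \<union> (\<lambda>b. \<psi> (to_ext (f b))) ` underS ?r a)"
    by auto
  from bounded_wrt_subset[OF bd this]
  show "bounded_wrt (le_mod F) (\<psi> ` topspace (top_of_set ?X))" .
qed

text \<open>Besides cofinality, the scale gets two properties for refuting Hurewicz: infinitely many
  gaps in each member, and gaps that \<open>d a\<close> does not eventually bound.\<close>

lemma cofinal_scale_escaping_exists:
  fixes d :: "(nat \<Rightarrow> nat) \<Rightarrow> nat \<Rightarrow> nat"
  assumes F: "semifilter F" and nb: "nonmeager_bounding F"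
    and dom: "dominating (d ` Field (bnum F))"
  obtains f where "cofinal_scale F f"
    "\<And>a. a \<in> Field (bnum F) \<Longrightarrow> infinite {n. 2 * n \<le> f a n}"
    "\<And>a N. a \<in> Field (bnum F) \<Longrightarrow> f a \<notin> gap_bounded (d a) N"
proof -
  let ?r = "bnum F"
  have wo: "Well_order ?r"
    using Card_order_bnum[OF F] by (simp add: card_order_on_def)
  then have wf: "wf (?r - Id)"
    by (simp add: well_order_on_def)
  \<comment> \<open>Being above \<open>2 n\<close> infinitely often forces the range to be co-infinite.\<close>
  define Y where "Y f a = f ` underS ?r a \<union> (d ` underS ?r a \<union> {d a, \<lambda>n. 2 * n})" for f a
  \<comment> \<open>Outside the field the condition is vacuous, so the recursion can run over the
    whole index type.\<close>
  define P where "P f a g \<longleftrightarrow> (a \<in> Field ?r \<longrightarrow>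
      g \<in> increasing_seqs \<and> (\<forall>y\<in>Y f a. le_mod F y g) \<and> g \<notin> (\<Union>N. gap_bounded (d a) N))" for f a g
  have "\<exists>f. \<forall>a. P f a (f a)"
  proof (rule dependent_wf_choice[OF wf])
    fix f f' :: "(nat \<Rightarrow> nat) \<Rightarrow> nat \<Rightarrow> nat" and a g
    assume "\<And>z. (z, a) \<in> ?r - Id \<Longrightarrow> f z = f' z"
    then have "f ` underS ?r a = f' ` underS ?r a"
      by (intro image_cong) (auto simp: underS_def)
    then show "P f a g = P f' a g"
      by (simp add: P_def Y_def)
  next
    fix a and f :: "(nat \<Rightarrow> nat) \<Rightarrow> nat \<Rightarrow> nat"
    show "\<exists>g. P f a g"
    proof (cases "a \<in> Field ?r")
      case True
      then have "|Y f a| <o ?r"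
        unfolding Y_def by (intro Un_less_bnum[OF F] image_underS_less_bnum[OF F] finite_less_bnum[OF F]) auto
      then have "\<not> meager_in (top_of_set increasing_seqs) {g \<in> increasing_seqs. \<forall>y\<in>Y f a. le_mod F y g}"
        using nb by (simp add: nonmeager_bounding_def)
      \<comment> \<open>The common upper bounds form a nonmeager set, which cannot fit inside a
        meager one; any point outside the latter is a valid choice.\<close>
      then have "\<not> {g \<in> increasing_seqs. \<forall>y\<in>Y f a. le_mod F y g} \<subseteq> (\<Union>N. gap_bounded (d a) N)"
        using meager_in_subset[OF meager_gap_bounded] by blast
      then show ?thesis
        unfolding P_def by blast
    qed (simp add: P_def)
  qed
  then obtain f where f: "\<And>a. P f a (f a)"
    by blast
  have inc: "f a \<in> increasing_seqs" and bd: "\<And>y. y \<in> Y f a \<Longrightarrow> le_mod F y (f a)"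
    and esc: "\<And>N. f a \<notin> gap_bounded (d a) N" if "a \<in> Field ?r" for a
    using f[of a] that by (auto simp: P_def)
  have "cofinal_scale F f"
    unfolding cofinal_scale_def
  proof (intro conjI ballI allI impI)
    show "f a \<in> increasing_seqs" if "a \<in> Field ?r" for a
      using inc that .
    show "le_mod F (f a) (f b)" if "(a, b) \<in> ?r" "a \<noteq> b" for a b
      using that by (intro bd) (auto simp: Y_def underS_def Field_def)
    fix g
    obtain a where a: "a \<in> Field ?r" "le_star g (d a)"
      using dom unfolding dominating_def by blast
    \<comment> \<open>The case \<open>b = a\<close> is included, which is why \<open>Y f a\<close>
      contains \<open>d a\<close> itself.\<close>
    have "le_mod F g (f b)" if "(a, b) \<in> ?r" for b
    proof (rule le_star_le_mod_trans[OF F a(2)])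
      show "le_mod F (d a) (f b)"
        using that by (intro bd) (auto simp: Y_def underS_def Field_def)
    qed
    with a(1) show "\<exists>a\<in>Field ?r. \<forall>b. (a, b) \<in> ?r \<longrightarrow> le_mod F g (f b)"
      by blast
  qed
  moreover have "infinite {n. 2 * n \<le> f a n}" if "a \<in> Field ?r" for a
    using bd[OF that, of "\<lambda>n. 2 * n"] semifilter_infinite[OF F] by (auto simp: Y_def le_mod_def)
  ultimately show ?thesis
    using that esc by blast
qed

text \<open>An isomorphism from \<open>bnum F\<close> to \<open>dnum\<close> indexes a dominating
  family of least cardinality by the indices of the scale.\<close>

lemma dominating_enumeration:
  assumes "bnum F =o dnum"
  obtains d where "dominating (d ` Field (bnum F))"
proof -
  obtain D where D: "dominating D" "dnum = |D|"
    unfolding dnum_def using min_card(1)[where P = dominating, OF dominating_UNIV] by blast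
  obtain d where "iso (bnum F) dnum d"
    using assms unfolding ordIso_def by blast
  then have "d ` Field (bnum F) = D"
    unfolding D(2) by (simp add: iso_def bij_betw_def Field_card_of)
  with D(1) that show ?thesis
    by blast
qed

theorem theorem3p9:
  fixes F :: "nat set set"
  assumes "semifilter F"
    and "nonmeager_bounding F"
    and "bnum F =o dnum"
  shows "\<exists>f. cofinal_scale F f \<and>
    (let S = f ` Field (bnum F);
         X = subtopology (top_of_set ext_increasing_seqs) (to_ext ` S \<union> Q)
     in B_property F X \<and> \<not> Hurewicz_property X)"
proof -
  obtain d where dom: "dominating (d ` Field (bnum F))"
    using dominating_enumeration[OF assms(3)] .
  obtain f where scale: "cofinal_scale F f"
    and fast: "\<And>a. a \<in> Field (bnum F) \<Longrightarrow> infinite {n. 2 * n \<le> f a n}"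
    and esc: "\<And>a N. a \<in> Field (bnum F) \<Longrightarrow> f a \<notin> gap_bounded (d a) N"
    using cofinal_scale_escaping_exists[OF assms(1,2) dom] by blast
  let ?X = "to_ext ` f ` Field (bnum F) \<union> Q"
  have inc: "f a \<in> increasing_seqs" if "a \<in> Field (bnum F)" for a
    using scale that by (simp add: cofinal_scale_def)
  then have sub: "?X \<subseteq> ext_increasing_seqs"
    unfolding ext_increasing_seqs_eq by auto
  have gaps: "infinite {k. enat k \<notin> range x}" if "x \<in> ?X" for x
    using that infinite_gaps_Q infinite_gaps_to_ext fast inc by (auto simp: increasing_seqs_def)
  have "\<not> Hurewicz_property (top_of_set ?X)"
  proof
    assume "Hurewicz_property (top_of_set ?X)"
    moreover have "continuous_map (top_of_set ?X) euclidean next_gap"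
      using continuous_on_next_gap[OF sub gaps] by simp
    ultimately have "bounded_wrt le_star (next_gap ` topspace (top_of_set ?X))"
      unfolding Hurewicz_property_def by blast
    then obtain h where h: "\<And>x. x \<in> ?X \<Longrightarrow> le_star (next_gap x) h"
      unfolding bounded_wrt_def by auto
    \<comment> \<open>The index \<open>a\<close> is chosen so that a bound \<open>h\<close> on the
      gaps of \<open>f a\<close> would give the bound \<open>d a\<close>, which \<open>f a\<close>
      was built to escape.\<close>
    obtain a where a: "a \<in> Field (bnum F)" "le_star h (d a)"
      using dom unfolding dominating_def by blast
    let ?x = "to_ext (f a)"
    have x: "?x \<in> ?X"
      using a(1) by blast
    obtain N where N: "\<And>n. n \<ge> N \<Longrightarrow> next_gap ?x n \<le> h n \<and> h n \<le> d a n"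
      using MOST_conjI[OF h[OF x, unfolded le_star_def] a(2)[unfolded le_star_def]]
      unfolding MOST_nat_le by blast
    have "\<exists>k\<in>{n..d a n}. k \<notin> range (f a)" if "n \<ge> N" for n
    proof (rule bexI)
      show "next_gap ?x n \<notin> range (f a)"
        using next_gap(2)[OF gaps[OF x], of n] by (auto simp: to_ext_def)
      show "next_gap ?x n \<in> {n..d a n}"
        using next_gap(1)[OF gaps[OF x], of n] N[OF that] by auto
    qed
    then have "f a \<in> gap_bounded (d a) N"
      using inc[OF a(1)] by (simp add: gap_bounded_def)
    with esc[OF a(1)] show False
      by blast
  qed
  moreover have "subtopology (top_of_set ext_increasing_seqs) ?X = top_of_set ?X"
    using sub by (simp add: subtopology_subtopology Int_absorb1)
  ultimately show ?thesis
    using scale B_property_cofinal_scale[OF assms(1) scale] by (auto simp: Let_def)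
qed

end
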